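(* Let $(\{s_i\}_{i=1,\dots,n},k,d)$ be an instance of \textsc{Minimax Approval Voting} with $s_i\in\{0,1\}^m$, let $\epsilon\in(0,3)$, and consider the randomized algorithm below. Assume there is a solution $s^*\in S_{k,m}$ (i.e. $\mathrm{H}(s^*,s_i)\le d$ for all $i$) and that the algorithm created a string $x_j$, for some $j\in\{0,\dots,d\}$. Then \[\Pr\left[\mathrm{H}(x_j,s^* )\le 2d-2j\right]\ge\left(\tfrac{\epsilon}{3}\right)^{2j}.\] The algorithm: if $|\mathrm{ones}(s_1)-k|>d$, return NO. Let $x_0$ be any $k$-completion of $s_1$. For $j=1,\dots,d$: if $\max_i\mathrm{H}(x_{j-1},s_i)\le(1+\epsilon)d$, return $x_{j-1}$; otherwise fix any $i$ with $\mathrm{H}(x_{j-1},s_i)>(1+\epsilon)d$, let $P_{j,0}=\{a\in[m]: x_{j-1}[a]=0,\ s_i[a]=1\}$ and $P_{j,1}=\{a\in[m]: x_{j-1}[a]=1,\ s_i[a]=0\}$; if $\min(|P_{j,0}|,|P_{j,1}|)=0$ return NO; otherwise choose $a_0\in P_{j,0}$ and $a_1\in P_{j,1}$ uniformly at random and obtain $x_j$ from $x_{j-1}$ by setting position $a_0$ to $1$ and position $a_1$ to $0$. After the loop, return $x_d$ if $\max_i\mathrm{H}(x_d,s_i)\le(1+\epsilon)d$, and NO otherwise.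
   Context: $[m]=\{1,\dots,m\}$; $s[a]$ is the $a$-th letter of $s$; $\mathrm{H}$ is Hamming distance; $\mathrm{ones}(s)$ is the number of $1$'s in $s$; $S_{k,m}$ is the set of strings in $\{0,1\}^m$ with exactly $k$ ones. A $k$-completion of $s\in\{0,1\}^m$ is any string $s'\in S_{k,m}$ with $\mathrm{H}(s,s')=|\mathrm{ones}(s)-k|$. \textsc{Minimax Approval Voting}: given a multiset $\{s_1,\dots,s_n\}\subseteq\{0,1\}^m$ and integers $k,d$, decide whether there is $s\in S_{k,m}$ with $\mathrm{H}(s,s_i)\le d$ for all $i$.
   Formalization: The assumption that x_j was created is placed inside the event: the bound is proved for Pr[if x_j is created then H(x_j,s* ) ≤ 2d−2j], so runs that stop earlier count as successes; conditioning on creation of x_j makes the claim false, since good runs may return early. *)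

theory Defs
  imports "HOL-Probability.Probability"
begin

text \<open>A string in \<open>{0,1}\<^sup>m\<close> is a \<^typ>\<open>bool list\<close> of length \<open>m\<close>, with \<^const>\<open>True\<close> for the
  letter 1. Positions are numbered from 0.\<close>

definition hamming :: "bool list \<Rightarrow> bool list \<Rightarrow> nat" where
  "hamming s t = card {a. a < length s \<and> s ! a \<noteq> t ! a}"

definition ones :: "bool list \<Rightarrow> nat" where
  "ones s = card {a. a < length s \<and> s ! a}"

definition S :: "nat \<Rightarrow> nat \<Rightarrow> bool list set" where
  "S k m = {s. length s = m \<and> ones s = k}"

definition k_completion :: "nat \<Rightarrow> bool list \<Rightarrow> bool list \<Rightarrow> bool" where
  "k_completion k s s' \<longleftrightarrow>
     s' \<in> S k (length s) \<and> int (hamming s s') = \<bar>int (ones s) - int k\<bar>"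

definition mav_solution ::
  "nat \<Rightarrow> nat \<Rightarrow> (nat \<Rightarrow> bool list) \<Rightarrow> nat \<Rightarrow> nat \<Rightarrow> bool list \<Rightarrow> bool" where
  "mav_solution m n s k d t \<longleftrightarrow> t \<in> S k m \<and> (\<forall>i\<in>{1..n}. hamming t (s i) \<le> d)"

datatype answer = NO | Return "bool list"

text \<open>A run is the list of all strings \<open>x\<^sub>0, x\<^sub>1, \<dots>\<close> that were created, together with the answer.\<close>

type_synonym run = "bool list list \<times> answer"

definition created :: "run \<Rightarrow> nat \<Rightarrow> bool" where
  "created r j \<longleftrightarrow> j < length (fst r)"

definition created_string :: "run \<Rightarrow> nat \<Rightarrow> bool list" where
  "created_string r j = fst r ! j"

definition good_approx ::
  "nat \<Rightarrow> (nat \<Rightarrow> bool list) \<Rightarrow> nat \<Rightarrow> real \<Rightarrow> bool list \<Rightarrow> bool" where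
  "good_approx n s d \<epsilon> x \<longleftrightarrow> real (MAX i\<in>{1..n}. hamming x (s i)) \<le> (1 + \<epsilon>) * real d"

definition P0 :: "bool list \<Rightarrow> bool list \<Rightarrow> nat set" where
  "P0 x t = {a. a < length x \<and> \<not> x ! a \<and> t ! a}"

definition P1 :: "bool list \<Rightarrow> bool list \<Rightarrow> nat set" where
  "P1 x t = {a. a < length x \<and> x ! a \<and> \<not> t ! a}"

text \<open>The choice of a violated index (``fix any \<open>i\<close>'') is a function of all strings created so far,
  so it may depend on the iteration and on the previous random choices.\<close>

definition valid_selection ::
  "nat \<Rightarrow> (nat \<Rightarrow> bool list) \<Rightarrow> nat \<Rightarrow> real \<Rightarrow> (bool list list \<Rightarrow> nat) \<Rightarrow> bool" where
  "valid_selection n s d \<epsilon> sel \<longleftrightarrow>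
     (\<forall>xs. xs \<noteq> [] \<and> (\<exists>i\<in>{1..n}. real (hamming (last xs) (s i)) > (1 + \<epsilon>) * real d) \<longrightarrow>
        sel xs \<in> {1..n} \<and> real (hamming (last xs) (s (sel xs))) > (1 + \<epsilon>) * real d)"

text \<open>\<open>mav_loop n s d \<epsilon> sel r xs\<close>: \<open>r\<close> iterations remain, \<open>xs\<close> are the strings created so far.\<close>

primrec mav_loop ::
  "nat \<Rightarrow> (nat \<Rightarrow> bool list) \<Rightarrow> nat \<Rightarrow> real \<Rightarrow> (bool list list \<Rightarrow> nat) \<Rightarrow>
   nat \<Rightarrow> bool list list \<Rightarrow> run pmf" where
  "mav_loop n s d \<epsilon> sel 0 xs =
     return_pmf (xs, if good_approx n s d \<epsilon> (last xs) then Return (last xs) else NO)"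
| "mav_loop n s d \<epsilon> sel (Suc r) xs =
     (let x = last xs; t = s (sel xs) in
      if good_approx n s d \<epsilon> x then return_pmf (xs, Return x)
      else if min (card (P0 x t)) (card (P1 x t)) = 0 then return_pmf (xs, NO)
      else bind_pmf (pmf_of_set (P0 x t)) (\<lambda>a0.
           bind_pmf (pmf_of_set (P1 x t)) (\<lambda>a1.
             mav_loop n s d \<epsilon> sel r (xs @ [x[a0 := True, a1 := False]]))))"

definition mav_algorithm ::
  "nat \<Rightarrow> (nat \<Rightarrow> bool list) \<Rightarrow> nat \<Rightarrow> nat \<Rightarrow> real \<Rightarrow> bool list \<Rightarrow>
   (bool list list \<Rightarrow> nat) \<Rightarrow> run pmf" where
  "mav_algorithm n s k d \<epsilon> x0 sel =
     (if \<bar>int (ones (s 1)) - int k\<bar> > int d then return_pmf ([], NO)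
      else mav_loop n s d \<epsilon> sel d [x0])"

end

theory Submission
  imports Defs
begin

text \<open>If the current string \<open>x\<close> has \<open>k\<close> ones, satisfies \<open>H(x,s\<^sup>*) \<le> 2d\<close>, and is far from \<open>t = s\<^sub>i\<close>, then
  counting letters shows that more than \<open>\<epsilon> d / 2\<close> positions in each of \<open>P\<^sub>0\<close> and \<open>P\<^sub>1\<close> are such that
  \<open>s\<^sup>*\<close> agrees with \<open>t\<close>, and \<open>|P\<^sub>0| + |P\<^sub>1| = H(x,t) \<le> 3d\<close>. By AM-GM, \<open>|P\<^sub>0| |P\<^sub>1| \<le> (3d/2)\<^sup>2\<close>, so both
  random choices hit such positions with probability at least \<open>(\<epsilon>/3)\<^sup>2\<close>, and then the distance to
  \<open>s\<^sup>*\<close> drops by 2. The two choices must be treated jointly: for \<open>\<epsilon> > 1\<close> a single one can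
  succeed with probability below \<open>\<epsilon>/3\<close>.\<close>

text \<open>Writing counts as sums of 0/1 terms lets inequalities between Hamming distances and
  numbers of ones be checked position by position.\<close>

lemma card_Collect_less_eq_sum:
  "card {a. a < (m::nat) \<and> Q a} = (\<Sum>a<m. of_bool (Q a))"
proof -
  have "{a. a < m \<and> Q a} = {..<m} \<inter> {a. Q a}" by auto
  then show ?thesis by (simp add: sum.inter_restrict)
qed

lemma hamming_triangle:
  assumes "length x = length y"
  shows "hamming x z \<le> hamming x y + hamming y z"
  unfolding hamming_def card_Collect_less_eq_sum assms sum.distrib[symmetric]
  by (rule sum_mono) auto

lemma hamming_sym: "length x = length y \<Longrightarrow> hamming x y = hamming y x"
  unfolding hamming_def by (metis (lifting))

lemma card_P0_P1: "card (P0 x t) + card (P1 x t) = hamming x t"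
  unfolding P0_def P1_def hamming_def card_Collect_less_eq_sum sum.distrib[symmetric]
  by (rule sum.cong) auto

text \<open>With \<open>u\<close> the solution, a flip inside \<open>good0\<close> or
  \<open>good1\<close> moves \<open>x\<close> towards both \<open>t\<close> and
  \<open>u\<close>.\<close>

definition good0 :: "bool list \<Rightarrow> bool list \<Rightarrow> bool list \<Rightarrow> nat set" where
  "good0 x t u = {a. a < length x \<and> \<not> x ! a \<and> t ! a \<and> u ! a}"

definition good1 :: "bool list \<Rightarrow> bool list \<Rightarrow> bool list \<Rightarrow> nat set" where
  "good1 x t u = {a. a < length x \<and> x ! a \<and> \<not> t ! a \<and> \<not> u ! a}"

lemma good0_subset: "good0 x t u \<subseteq> P0 x t"
  and good1_subset: "good1 x t u \<subseteq> P1 x t"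
  by (auto simp: good0_def good1_def P0_def P1_def)

lemma finite_P0 [simp]: "finite (P0 x t)"
  and finite_P1 [simp]: "finite (P1 x t)"
  by (auto simp: P0_def P1_def)

lemma
  assumes "length u = length x" "ones u = ones x"
  shows card_good0_ge: "hamming x t \<le> 2 * card (good0 x t u) + hamming u t"
    and card_good1_ge: "hamming x t \<le> 2 * card (good1 x t u) + hamming u t"
proof -
  \<comment> \<open>The equal terms \<open>ones u\<close> and \<open>ones x\<close> cancel in the
    total, but make the inequality true at every single position: where \<open>x\<close> has 1 and
    \<open>t\<close>, \<open>u\<close> have 0, it would fail without \<open>ones x\<close>.\<close>
  have "hamming x t + ones u \<le> 2 * card (good0 x t u) + hamming u t + ones x"
    unfolding hamming_def ones_def good0_def card_Collect_less_eq_sum assms(1)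
      sum.distrib[symmetric] sum_distrib_left
    by (rule sum_mono) auto
  then show "hamming x t \<le> 2 * card (good0 x t u) + hamming u t" using assms by simp
  have "hamming x t + ones x \<le> 2 * card (good1 x t u) + hamming u t + ones u"
    unfolding hamming_def ones_def good1_def card_Collect_less_eq_sum assms(1)
      sum.distrib[symmetric] sum_distrib_left
    by (rule sum_mono) auto
  then show "hamming x t \<le> 2 * card (good1 x t u) + hamming u t" using assms by simp
qed

lemma hamming_good_update:
  assumes "a0 \<in> good0 x t u" "a1 \<in> good1 x t u"
  shows "hamming (x[a0 := True, a1 := False]) u + 2 = hamming x u"
proof -
  let ?D = "{a. a < length x \<and> x ! a \<noteq> u ! a}"
  have ne: "a0 \<noteq> a1" and sub: "{a0, a1} \<subseteq> ?D"
    using assms by (auto simp: good0_def good1_def)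
  have "{a. a < length (x[a0 := True, a1 := False]) \<and> x[a0 := True, a1 := False] ! a \<noteq> u ! a}
      = ?D - {a0, a1}"
    using assms by (auto simp: good0_def good1_def nth_list_update)
  moreover have "card (?D - {a0, a1}) + card {a0, a1} = card ?D"
    using sub card_mono[OF _ sub] by (subst card_Diff_subset) auto
  ultimately show ?thesis using ne by (simp add: hamming_def)
qed

lemma ones_update:
  assumes "a0 \<in> P0 x t" "a1 \<in> P1 x t"
  shows "ones (x[a0 := True, a1 := False]) = ones x"
proof -
  let ?D = "{a. a < length x \<and> x ! a}"
  have "{a. a < length (x[a0 := True, a1 := False]) \<and> x[a0 := True, a1 := False] ! a}
      = insert a0 (?D - {a1})"
    using assms by (auto simp: P0_def P1_def nth_list_update)
  moreover have "a0 \<notin> ?D" "a1 \<in> ?D" using assms by (auto simp: P0_def P1_def)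
  ultimately show ?thesis unfolding ones_def
    by (simp add: card_Suc_Diff1 del: mem_Collect_eq card_Diff_insert)
qed

lemma prob_good_choice:
  assumes "length u = length x" "ones u = ones x" "hamming x u \<le> 2 * d" "hamming u t \<le> d"
    and far: "real (hamming x t) > (1 + \<epsilon>) * real d" and "\<epsilon> > 0"
  shows "(\<epsilon> / 3)\<^sup>2 \<le> (card (good0 x t u) / card (P0 x t)) * (card (good1 x t u) / card (P1 x t))"
proof -
  define g0 g1 p0 p1 where defs: "g0 = real (card (good0 x t u))" "g1 = real (card (good1 x t u))"
    "p0 = real (card (P0 x t))" "p1 = real (card (P1 x t))"
  have "real (hamming x t) \<le> 2 * g0 + real d" "real (hamming x t) \<le> 2 * g1 + real d"
    unfolding defs using card_good0_ge[OF assms(1,2), of t] card_good1_ge[OF assms(1,2), of t]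
      assms(4) by linarith+
  with far have g: "\<epsilon> * d < 2 * g0" "\<epsilon> * d < 2 * g1" by (simp_all add: algebra_simps)
  have gp: "g0 \<le> p0" "g1 \<le> p1"
    unfolding defs by (simp_all add: card_mono good0_subset good1_subset)
  \<comment> \<open>As the bounds \<open>g\<close> are strict, \<open>p0\<close> and
    \<open>p1\<close> are positive even for \<open>d = 0\<close>, which justifies the final
    divisions.\<close>
  have "0 \<le> \<epsilon> * d" using \<open>\<epsilon> > 0\<close> by simp
  with g gp have pos: "p0 > 0" "p1 > 0" by linarith+
  \<comment> \<open>Going through \<open>u\<close> costs at most \<open>2 * d\<close> from
    \<open>x\<close> and \<open>d\<close> more to \<open>t\<close>.\<close>
  have "hamming x t \<le> 3 * d"
    using hamming_triangle[of x u t] assms by simp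
  then have "p0 + p1 \<le> 3 * real d" unfolding defs using card_P0_P1[of x t] by linarith
  then have "(p0 + p1)\<^sup>2 \<le> (3 * real d)\<^sup>2" using pos by (intro power_mono) auto
  moreover have "4 * (p0 * p1) \<le> (p0 + p1)\<^sup>2"
    using zero_le_power2[of "p0 - p1"] by (simp add: power2_eq_square algebra_simps)
  ultimately have "4 * (p0 * p1) \<le> 9 * real d * real d" by (simp add: power2_eq_square)
  then have "\<epsilon>\<^sup>2 * (4 * (p0 * p1)) \<le> \<epsilon>\<^sup>2 * (9 * real d * real d)"
    by (intro mult_left_mono) auto
  also have "\<dots> = 9 * ((\<epsilon> * d) * (\<epsilon> * d))" by (simp add: power2_eq_square)
  also have "\<dots> \<le> 9 * ((2 * g0) * (2 * g1))"
    using g \<open>0 \<le> \<epsilon> * d\<close> by (intro mult_left_mono mult_mono[of "\<epsilon> * d" _ "\<epsilon> * d"]) auto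
  finally have "\<epsilon>\<^sup>2 * (p0 * p1) \<le> 9 * (g0 * g1)" by (simp add: mult_ac)
  then have "(\<epsilon> / 3)\<^sup>2 \<le> (g0 / p0) * (g1 / p1)"
    using pos by (simp add: field_simps power2_eq_square)
  then show ?thesis unfolding defs .
qed

text \<open>The left side is the integral of \<open>c\<close> over \<open>G\<close>, and
  \<open>c\<close> bounds the conditional probability there from below. Nonnegative integrals avoid
  integrability conditions.\<close>

lemma prob_bind_pmf_ge:
  assumes "\<And>x. x \<in> G \<Longrightarrow> c \<le> measure_pmf.prob (f x) A" "0 \<le> c"
  shows "measure_pmf.prob p G * c \<le> measure_pmf.prob (bind_pmf p f) A"
proof -
  have "ennreal (measure_pmf.prob p G * c) = (\<integral>\<^sup>+x. ennreal c * indicator G x \<partial>measure_pmf p)"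
    using assms(2)
    by (simp add: nn_integral_cmult_indicator measure_pmf.emeasure_eq_measure ennreal_mult mult.commute)
  also have "\<dots> \<le> (\<integral>\<^sup>+x. emeasure (measure_pmf (f x)) A \<partial>measure_pmf p)"
    using assms by (intro nn_integral_mono)
      (auto simp: indicator_def measure_pmf.emeasure_eq_measure ennreal_leI)
  also have "\<dots> = ennreal (measure_pmf.prob (bind_pmf p f) A)"
    by (simp add: measure_pmf.emeasure_eq_measure[symmetric])
  finally show ?thesis by simp
qed

text \<open>\<open>B\<close> and \<open>H\<close> do not depend on the first draw, so the two
  hitting probabilities multiply.\<close>

lemma prob_uniform_pair_ge:
  assumes "finite A" "finite B" "A \<noteq> {}" "B \<noteq> {}" "G \<subseteq> A" "H \<subseteq> B"
    and "\<And>a b. a \<in> G \<Longrightarrow> b \<in> H \<Longrightarrow> c \<le> measure_pmf.prob (f a b) E" "0 \<le> c"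
  shows "(card G / card A) * (card H / card B) * c
    \<le> measure_pmf.prob (bind_pmf (pmf_of_set A) (\<lambda>a. bind_pmf (pmf_of_set B) (f a))) E"
proof -
  have pr: "measure_pmf.prob (pmf_of_set A) G = card G / card A"
    "measure_pmf.prob (pmf_of_set B) H = card H / card B"
    using assms by (simp_all add: measure_pmf_of_set Int_absorb1)
  have "measure_pmf.prob (pmf_of_set A) G * (measure_pmf.prob (pmf_of_set B) H * c)
    \<le> measure_pmf.prob (bind_pmf (pmf_of_set A) (\<lambda>a. bind_pmf (pmf_of_set B) (f a))) E"
    using assms(7,8) by (intro prob_bind_pmf_ge) auto
  then show ?thesis by (simp add: pr mult.assoc)
qed

text \<open>Later iterations only append, so a string once created keeps its index.\<close>

lemma mav_loop_extends:
  "r \<in> set_pmf (mav_loop n s d \<epsilon> sel i xs) \<Longrightarrow> \<exists>ys. fst r = xs @ ys"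
proof (induction i arbitrary: xs)
  case (Suc i)
  then show ?case
    by (fastforce simp: Let_def split: if_splits)
qed simp

text \<open>Connects the loop test with the premise of \<open>valid_selection\<close>;
  \<open>n \<ge> 1\<close> keeps the maximum over a nonempty set.\<close>

lemma not_good_approx_iff:
  assumes "n \<ge> 1"
  shows "\<not> good_approx n s d \<epsilon> x \<longleftrightarrow> (\<exists>i\<in>{1..n}. real (hamming x (s i)) > (1 + \<epsilon>) * real d)"
proof -
  let ?M = "MAX i\<in>{1..n}. hamming x (s i)"
  have "?M \<in> (\<lambda>i. hamming x (s i)) ` {1..n}" using assms by (intro Max_in) auto
  moreover have "hamming x (s i) \<le> ?M" if "i \<in> {1..n}" for i using that by (intro Max_ge) auto
  ultimately show ?thesis unfolding good_approx_def
    by (smt (verit, best) imageE of_nat_mono)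
qed

text \<open>Generalizes from \<open>[x0]\<close> to any partial run so that induction on the
  remaining iterations applies. The last string has index \<open>length xs - 1\<close>, and the
  distance bound is the invariant that every swap so far was good. The exponent charges two for each
  swap still missing before index \<open>j\<close>. Runs that stop earlier belong to the
  event.\<close>

lemma mav_loop_prob_ge:
  fixes \<epsilon> :: real
  assumes "n \<ge> 1" "0 < \<epsilon>" "\<epsilon> < 3"
    and sol: "mav_solution m n s k d u" and sel: "valid_selection n s d \<epsilon> sel"
    and "xs \<noteq> []" "last xs \<in> S k m" "length xs \<le> Suc j"
    and "hamming (last xs) u + 2 * (length xs - 1) \<le> 2 * d"
  shows "(\<epsilon> / 3) ^ (2 * (Suc j - length xs)) \<le> measure_pmf.prob (mav_loop n s d \<epsilon> sel i xs)
    {r. created r j \<longrightarrow> int (hamming (created_string r j) u) \<le> 2 * int d - 2 * int j}"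
  (is "_ \<le> measure_pmf.prob _ ?E")
  using assms(6-)
proof (induction i arbitrary: xs)
  case (0 xs)
  have "(xs, b) \<in> ?E" for b
    using 0 by (cases "length xs = Suc j") (auto simp: created_def created_string_def last_conv_nth)
  then show ?case using assms(2,3) by (simp add: power_le_one)
next
  case (Suc i xs)
  let ?x = "last xs" and ?t = "s (sel xs)" and ?L = "mav_loop n s d \<epsilon> sel (Suc i) xs"
  have le1: "(\<epsilon> / 3) ^ q \<le> 1" for q using assms(2,3) by (simp add: power_le_one)
  \<comment> \<open>Either the string of index \<open>j\<close> is already the last one, or the run
    halts before creating it, or one more swap is made.\<close>
  consider (reached) "length xs = Suc j"
    | (stop) "length xs \<le> j" "good_approx n s d \<epsilon> ?x \<or> min (card (P0 ?x ?t)) (card (P1 ?x ?t)) = 0"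
    | (step) "length xs \<le> j" "\<not> good_approx n s d \<epsilon> ?x" "card (P0 ?x ?t) \<noteq> 0" "card (P1 ?x ?t) \<noteq> 0"
    using Suc.prems(3) by linarith
  then show ?case
  proof cases
    case reached
    have "r \<in> ?E" if r: "r \<in> set_pmf ?L" for r
    proof -
      obtain ys where "fst r = xs @ ys" using mav_loop_extends[OF r] by blast
      then have "created_string r j = ?x"
        using reached Suc.prems(1) by (simp add: created_string_def nth_append last_conv_nth)
      then show ?thesis using Suc.prems(4) reached by simp
    qed
    then have "measure_pmf.prob ?L ?E = 1"
      by (subst measure_pmf.prob_eq_1) (auto simp: AE_measure_pmf_iff)
    then show ?thesis using le1 by metis
  next
    case stop
    then have "(xs, b) \<in> ?E" for b by (simp add: created_def)
    then show ?thesis using stop le1 by (auto simp: Let_def)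
  next
    case step
    have t: "sel xs \<in> {1..n}" "real (hamming ?x ?t) > (1 + \<epsilon>) * real d"
      using sel step(2) Suc.prems(1) not_good_approx_iff[OF assms(1)]
      unfolding valid_selection_def by blast+
    have u: "length u = length ?x" "ones u = ones ?x" "hamming u ?t \<le> d"
      using sol Suc.prems(2) t(1) by (auto simp: mav_solution_def S_def)
    have IH: "(\<epsilon> / 3) ^ (2 * (j - length xs))
        \<le> measure_pmf.prob (mav_loop n s d \<epsilon> sel i (xs @ [?x[a0 := True, a1 := False]])) ?E"
      if "a0 \<in> good0 ?x ?t u" "a1 \<in> good1 ?x ?t u" for a0 a1
    proof -
      let ?y = "?x[a0 := True, a1 := False]"
      have "?y \<in> S k m"
        using Suc.prems(2) that good0_subset good1_subset ones_update[of a0 ?x ?t a1]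
        by (fastforce simp: S_def)
      \<comment> \<open>The distance drops by 2 as the list grows by 1. Splitting \<open>xs\<close>
        resolves the truncated \<open>length xs - 1\<close>.\<close>
      moreover have "hamming ?y u + 2 * length xs \<le> 2 * d"
        using hamming_good_update[OF that] Suc.prems(1,4) by (cases xs) auto
      ultimately show ?thesis using Suc.IH[of "xs @ [?y]"] step(1) by simp
    qed
    \<comment> \<open>One square pays for the current swap, the rest is left to the induction
      hypothesis.\<close>
    have "(\<epsilon> / 3) ^ (2 * (Suc j - length xs)) = (\<epsilon> / 3)\<^sup>2 * (\<epsilon> / 3) ^ (2 * (j - length xs))"
      using step(1) by (simp add: Suc_diff_le power2_eq_square)
    also have "\<dots> \<le> (card (good0 ?x ?t u) / card (P0 ?x ?t)) * (card (good1 ?x ?t u) / card (P1 ?x ?t))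
        * (\<epsilon> / 3) ^ (2 * (j - length xs))"
      using prob_good_choice[OF u(1,2) _ u(3) t(2) assms(2)] Suc.prems(4) assms(2)
      by (intro mult_right_mono) auto
    also have "\<dots> \<le> measure_pmf.prob (bind_pmf (pmf_of_set (P0 ?x ?t)) (\<lambda>a0.
        bind_pmf (pmf_of_set (P1 ?x ?t)) (\<lambda>a1.
          mav_loop n s d \<epsilon> sel i (xs @ [?x[a0 := True, a1 := False]])))) ?E"
      using step(3,4) assms(2) good0_subset good1_subset IH
      by (intro prob_uniform_pair_ge) auto
    also have "\<dots> = measure_pmf.prob ?L ?E"
      using step by (simp add: Let_def min_def)
    finally show ?thesis .
  qed
qed

theorem corollary1:
  fixes m n k d j :: nat and s :: "nat \<Rightarrow> bool list" and \<epsilon> :: real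
    and x0 sstar :: "bool list" and sel :: "bool list list \<Rightarrow> nat"
  assumes "n \<ge> 1"
    and "\<forall>i\<in>{1..n}. length (s i) = m"
    and "0 < \<epsilon>" and "\<epsilon> < 3"
    and "mav_solution m n s k d sstar"
    and "k_completion k (s 1) x0"
    and "valid_selection n s d \<epsilon> sel"
    and "j \<le> d"
  shows "measure_pmf.prob (mav_algorithm n s k d \<epsilon> x0 sel)
           {r. created r j \<longrightarrow>
               int (hamming (created_string r j) sstar) \<le> 2 * int d - 2 * int j}
         \<ge> (\<epsilon> / 3) ^ (2 * j)"
proof (cases "\<bar>int (ones (s 1)) - int k\<bar> > int d")
  \<comment> \<open>No string is created here, so the event is certain.\<close>
  case True
  then show ?thesis using assms
    by (simp add: mav_algorithm_def created_def power_le_one)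
next
  case False
  have len: "length (s 1) = m" "length sstar = m" "length x0 = m" and x0: "x0 \<in> S k m"
    using assms by (auto simp: mav_solution_def k_completion_def S_def)
  have "hamming x0 (s 1) \<le> d"
    using assms(6) False len hamming_sym[of x0 "s 1"] by (auto simp: k_completion_def)
  moreover have "hamming (s 1) sstar \<le> d"
    using assms(1,5) len hamming_sym[of sstar "s 1"] by (force simp: mav_solution_def)
  \<comment> \<open>This is the loop invariant for the one-element list \<open>[x0]\<close>.\<close>
  ultimately have "hamming x0 sstar \<le> 2 * d"
    using hamming_triangle[of x0 "s 1" sstar] len by simp
  then show ?thesis
    using mav_loop_prob_ge[OF assms(1,3,4,5,7), of "[x0]" j d] x0 False
    by (simp add: mav_algorithm_def)
qed

end
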